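(* Every formula $\varphi\in Fm$ is equivalent, both through the interderivability relation of $\vdash_H$ and through that of $\models_{\mathcal{LB}}$, to a $\land$-conjunction of clauses with the same variables. That is, for every $\varphi\in Fm$ there is a formula $\psi$ which is a (finite, nonempty) $\land$-conjunction of clauses, in which exactly the variables of $\varphi$ occur, and such that $\varphi\vdash_H\psi$, $\psi\vdash_H\varphi$, $\varphi\models_{\mathcal{LB}}\psi$ and $\psi\models_{\mathcal{LB}}\varphi$.
   Context: $\mathbf{Fm}$ is the algebra of formulas (with universe $Fm$) over a countable set of variables in the language $\{\land,\lor,\otimes,\oplus,\neg\}$ ($\land,\lor,\otimes,\oplus$ binary, $\neg$ unary, no constants). A literal is a variable or a formula $\neg p$ with $p$ a variable. The set of clauses is the least set of formulas containing all literals and closed under $\lor$. $\mathcal{FOUR}$ is the algebra with universe $\{\mathsf f,\bot,\top,\mathsf t\}$ where $\land,\lor$ are meet and join of the lattice order $\leq_t$ with $\mathsf f <_t \bot,\top <_t \mathsf t$ ($\bot,\top$ $\leq_t$-incomparable), $\otimes,\oplus$ are meet and join of the lattice order $\leq_k$ with $\bot <_k \mathsf f,\mathsf t <_k \top$ ($\mathsf f,\mathsf t$ $\leq_k$-incomparable), and $\neg \mathsf f = \mathsf t$, $\neg\mathsf t=\mathsf f$, $\neg\bot=\bot$, $\neg\top=\top$. Let $\mathsf{Tr}=\{\top,\mathsf t\}$. Define $\Gamma\models_{\mathcal{LB}}\varphi$ iff for every homomorphism $h:\mathbf{Fm}\to\mathcal{FOUR}$, $h[\Gamma]\subseteq \mathsf{Tr}$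 implies $h(\varphi)\in\mathsf{Tr}$. $\vdash_H$ is the (finitary, substitution-invariant) consequence relation given by the Hilbert calculus with no axioms and the following rules (premises $/$ conclusion): (R1) $p\land q / p$; (R2) $p\land q/q$; (R3) $p, q/ p\land q$; (R4) $p/p\lor q$; (R5) $p\lor q/q\lor p$; (R6) $p\lor p/p$; (R7) $p\lor(q\lor r)/(p\lor q)\lor r$; (R8) $p\lor(q\land r)/(p\lor q)\land(p\lor r)$; (R9) $(p\lor q)\land(p\lor r)/p\lor(q\land r)$; (R10) $p\lor r/\neg\neg p\lor r$; (R11) $\neg\neg p\lor r/p\lor r$; (R12) $\neg(p\lor q)\lor r/(\neg p\land\neg q)\lor r$; (R13) $(\neg p\land\neg q)\lor r/\neg(p\lor q)\lor r$; (R14) $\neg(p\land q)\lor r/(\neg p\lor\neg q)\lor r$; (R15) $(\neg p\lor\neg q)\lor r/\neg(p\land q)\lor r$; (R16) $(p\otimes q)\lor r/(p\land q)\lor r$; (R17) $(p\land q)\lor r/(p\otimes q)\lor r$; (R18) $(p\oplus q)\lor r/(p\lor q)\lor r$; (R19) $(p\lor q)\lor r/(p\oplus q)\lor r$; (R20) $(\neg p\otimes\neg q)\lor r/\neg(p\otimes q)\lor r$; (R21) $\neg(p\otimes q)\lor r/(\neg p\otimes\neg q)\lor r$; (R22) $(\neg p\oplus\neg q)\lor r/\neg(p\oplus q)\lor r$; (R23) $\neg(p\oplus q)\lor r/(\neg p\oplus\neg q)\lor r$. *)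

theory Defs
  imports Main "HOL-Library.Countable"
begin

section \<open>Formulas and clauses\<close>

datatype (vars: 'v) fm =
    Var 'v
  | Neg "'v fm"                 (\<open>\<^bold>\<not> _\<close> [80] 80)
  | Conj "'v fm" "'v fm"        (infixr \<open>\<^bold>\<and>\<close> 70)
  | Disj "'v fm" "'v fm"        (infixr \<open>\<^bold>\<or>\<close> 65)
  | KConj "'v fm" "'v fm"       (infixr \<open>\<^bold>\<otimes>\<close> 70)
  | KDisj "'v fm" "'v fm"       (infixr \<open>\<^bold>\<oplus>\<close> 65)

inductive literal :: "'v fm \<Rightarrow> bool" where
  "literal (Var x)"
| "literal (\<^bold>\<not> Var x)"

inductive clause :: "'v fm \<Rightarrow> bool" where
  "literal \<phi> \<Longrightarrow> clause \<phi>"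
| "clause \<phi> \<Longrightarrow> clause \<psi> \<Longrightarrow> clause (\<phi> \<^bold>\<or> \<psi>)"

text \<open>Finite nonempty conjunctions, with arbitrary bracketing.\<close>

inductive conj_of_clauses :: "'v fm \<Rightarrow> bool" where
  "clause \<phi> \<Longrightarrow> conj_of_clauses \<phi>"
| "conj_of_clauses \<phi> \<Longrightarrow> conj_of_clauses \<psi> \<Longrightarrow> conj_of_clauses (\<phi> \<^bold>\<and> \<psi>)"


section \<open>The algebra FOUR and its logic\<close>

datatype four = Fls | Bot | Top | Tru

definition leq_t :: "four \<Rightarrow> four \<Rightarrow> bool" where
  "leq_t a b \<longleftrightarrow> a = b \<or> a = Fls \<or> b = Tru"

definition leq_k :: "four \<Rightarrow> four \<Rightarrow> bool" where
  "leq_k a b \<longleftrightarrow> a = b \<or> a = Bot \<or> b = Top"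

text \<open>Two incomparable elements have the least element as meet and the greatest one as join.
  The lemmas below confirm that these are the lattice operations of the two orders.\<close>

definition meet_t :: "four \<Rightarrow> four \<Rightarrow> four" where
  "meet_t a b = (if leq_t a b then a else if leq_t b a then b else Fls)"

definition join_t :: "four \<Rightarrow> four \<Rightarrow> four" where
  "join_t a b = (if leq_t a b then b else if leq_t b a then a else Tru)"

definition meet_k :: "four \<Rightarrow> four \<Rightarrow> four" where
  "meet_k a b = (if leq_k a b then a else if leq_k b a then b else Bot)"

definition join_k :: "four \<Rightarrow> four \<Rightarrow> four" where
  "join_k a b = (if leq_k a b then b else if leq_k b a then a else Top)"

lemma lattice_t: "class.lattice meet_t leq_t (\<lambda>a b. leq_t a b \<and> a \<noteq> b) join_t"
  by unfold_locales (auto simp: meet_t_def join_t_def leq_t_def split: if_splits intro: four.exhaust)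

lemma lattice_k: "class.lattice meet_k leq_k (\<lambda>a b. leq_k a b \<and> a \<noteq> b) join_k"
  by unfold_locales (auto simp: meet_k_def join_k_def leq_k_def split: if_splits intro: four.exhaust)

fun neg4 :: "four \<Rightarrow> four" where
  "neg4 Fls = Tru"
| "neg4 Tru = Fls"
| "neg4 Bot = Bot"
| "neg4 Top = Top"

definition Tr :: "four set" where
  "Tr = {Top, Tru}"

definition hom_four :: "('v fm \<Rightarrow> four) \<Rightarrow> bool" where
  "hom_four h \<longleftrightarrow>
     (\<forall>\<phi>. h (\<^bold>\<not> \<phi>) = neg4 (h \<phi>)) \<and>
     (\<forall>\<phi> \<psi>. h (\<phi> \<^bold>\<and> \<psi>) = meet_t (h \<phi>) (h \<psi>)) \<and>
     (\<forall>\<phi> \<psi>. h (\<phi> \<^bold>\<or> \<psi>) = join_t (h \<phi>) (h \<psi>)) \<and>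
     (\<forall>\<phi> \<psi>. h (\<phi> \<^bold>\<otimes> \<psi>) = meet_k (h \<phi>) (h \<psi>)) \<and>
     (\<forall>\<phi> \<psi>. h (\<phi> \<^bold>\<oplus> \<psi>) = join_k (h \<phi>) (h \<psi>))"

definition models_LB :: "'v fm set \<Rightarrow> 'v fm \<Rightarrow> bool" (infix \<open>\<Turnstile>\<^sub>L\<^sub>B\<close> 50) where
  "\<Gamma> \<Turnstile>\<^sub>L\<^sub>B \<phi> \<longleftrightarrow> (\<forall>h. hom_four h \<longrightarrow> h ` \<Gamma> \<subseteq> Tr \<longrightarrow> h \<phi> \<in> Tr)"


section \<open>The Hilbert calculus\<close>

text \<open>Here \<open>p\<close>, \<open>q\<close>, \<open>r\<close> range over all formulas, so that each rule stands for all its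
  substitution instances.\<close>

inductive derives_H :: "'v fm set \<Rightarrow> 'v fm \<Rightarrow> bool" (infix \<open>\<turnstile>\<^sub>H\<close> 50)
  for \<Gamma> :: "'v fm set" where
  Prem: "\<phi> \<in> \<Gamma> \<Longrightarrow> \<Gamma> \<turnstile>\<^sub>H \<phi>"
| R1: "\<Gamma> \<turnstile>\<^sub>H p \<^bold>\<and> q \<Longrightarrow> \<Gamma> \<turnstile>\<^sub>H p"
| R2: "\<Gamma> \<turnstile>\<^sub>H p \<^bold>\<and> q \<Longrightarrow> \<Gamma> \<turnstile>\<^sub>H q"
| R3: "\<Gamma> \<turnstile>\<^sub>H p \<Longrightarrow> \<Gamma> \<turnstile>\<^sub>H q \<Longrightarrow> \<Gamma> \<turnstile>\<^sub>H p \<^bold>\<and> q"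
| R4: "\<Gamma> \<turnstile>\<^sub>H p \<Longrightarrow> \<Gamma> \<turnstile>\<^sub>H p \<^bold>\<or> q"
| R5: "\<Gamma> \<turnstile>\<^sub>H p \<^bold>\<or> q \<Longrightarrow> \<Gamma> \<turnstile>\<^sub>H q \<^bold>\<or> p"
| R6: "\<Gamma> \<turnstile>\<^sub>H p \<^bold>\<or> p \<Longrightarrow> \<Gamma> \<turnstile>\<^sub>H p"
| R7: "\<Gamma> \<turnstile>\<^sub>H p \<^bold>\<or> (q \<^bold>\<or> r) \<Longrightarrow> \<Gamma> \<turnstile>\<^sub>H (p \<^bold>\<or> q) \<^bold>\<or> r"
| R8: "\<Gamma> \<turnstile>\<^sub>H p \<^bold>\<or> (q \<^bold>\<and> r) \<Longrightarrow> \<Gamma> \<turnstile>\<^sub>H (p \<^bold>\<or> q) \<^bold>\<and> (p \<^bold>\<or> r)"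
| R9: "\<Gamma> \<turnstile>\<^sub>H (p \<^bold>\<or> q) \<^bold>\<and> (p \<^bold>\<or> r) \<Longrightarrow> \<Gamma> \<turnstile>\<^sub>H p \<^bold>\<or> (q \<^bold>\<and> r)"
| R10: "\<Gamma> \<turnstile>\<^sub>H p \<^bold>\<or> r \<Longrightarrow> \<Gamma> \<turnstile>\<^sub>H (\<^bold>\<not> (\<^bold>\<not> p)) \<^bold>\<or> r"
| R11: "\<Gamma> \<turnstile>\<^sub>H (\<^bold>\<not> (\<^bold>\<not> p)) \<^bold>\<or> r \<Longrightarrow> \<Gamma> \<turnstile>\<^sub>H p \<^bold>\<or> r"
| R12: "\<Gamma> \<turnstile>\<^sub>H (\<^bold>\<not> (p \<^bold>\<or> q)) \<^bold>\<or> r \<Longrightarrow> \<Gamma> \<turnstile>\<^sub>H ((\<^bold>\<not> p) \<^bold>\<and> (\<^bold>\<not> q)) \<^bold>\<or> r"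
| R13: "\<Gamma> \<turnstile>\<^sub>H ((\<^bold>\<not> p) \<^bold>\<and> (\<^bold>\<not> q)) \<^bold>\<or> r \<Longrightarrow> \<Gamma> \<turnstile>\<^sub>H (\<^bold>\<not> (p \<^bold>\<or> q)) \<^bold>\<or> r"
| R14: "\<Gamma> \<turnstile>\<^sub>H (\<^bold>\<not> (p \<^bold>\<and> q)) \<^bold>\<or> r \<Longrightarrow> \<Gamma> \<turnstile>\<^sub>H ((\<^bold>\<not> p) \<^bold>\<or> (\<^bold>\<not> q)) \<^bold>\<or> r"
| R15: "\<Gamma> \<turnstile>\<^sub>H ((\<^bold>\<not> p) \<^bold>\<or> (\<^bold>\<not> q)) \<^bold>\<or> r \<Longrightarrow> \<Gamma> \<turnstile>\<^sub>H (\<^bold>\<not> (p \<^bold>\<and> q)) \<^bold>\<or> r"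
| R16: "\<Gamma> \<turnstile>\<^sub>H (p \<^bold>\<otimes> q) \<^bold>\<or> r \<Longrightarrow> \<Gamma> \<turnstile>\<^sub>H (p \<^bold>\<and> q) \<^bold>\<or> r"
| R17: "\<Gamma> \<turnstile>\<^sub>H (p \<^bold>\<and> q) \<^bold>\<or> r \<Longrightarrow> \<Gamma> \<turnstile>\<^sub>H (p \<^bold>\<otimes> q) \<^bold>\<or> r"
| R18: "\<Gamma> \<turnstile>\<^sub>H (p \<^bold>\<oplus> q) \<^bold>\<or> r \<Longrightarrow> \<Gamma> \<turnstile>\<^sub>H (p \<^bold>\<or> q) \<^bold>\<or> r"
| R19: "\<Gamma> \<turnstile>\<^sub>H (p \<^bold>\<or> q) \<^bold>\<or> r \<Longrightarrow> \<Gamma> \<turnstile>\<^sub>H (p \<^bold>\<oplus> q) \<^bold>\<or> r"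
| R20: "\<Gamma> \<turnstile>\<^sub>H ((\<^bold>\<not> p) \<^bold>\<otimes> (\<^bold>\<not> q)) \<^bold>\<or> r \<Longrightarrow> \<Gamma> \<turnstile>\<^sub>H (\<^bold>\<not> (p \<^bold>\<otimes> q)) \<^bold>\<or> r"
| R21: "\<Gamma> \<turnstile>\<^sub>H (\<^bold>\<not> (p \<^bold>\<otimes> q)) \<^bold>\<or> r \<Longrightarrow> \<Gamma> \<turnstile>\<^sub>H ((\<^bold>\<not> p) \<^bold>\<otimes> (\<^bold>\<not> q)) \<^bold>\<or> r"
| R22: "\<Gamma> \<turnstile>\<^sub>H ((\<^bold>\<not> p) \<^bold>\<oplus> (\<^bold>\<not> q)) \<^bold>\<or> r \<Longrightarrow> \<Gamma> \<turnstile>\<^sub>H (\<^bold>\<not> (p \<^bold>\<oplus> q)) \<^bold>\<or> r"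
| R23: "\<Gamma> \<turnstile>\<^sub>H (\<^bold>\<not> (p \<^bold>\<oplus> q)) \<^bold>\<or> r \<Longrightarrow> \<Gamma> \<turnstile>\<^sub>H ((\<^bold>\<not> p) \<^bold>\<oplus> (\<^bold>\<not> q)) \<^bold>\<or> r"

end

theory Submission
  imports Defs
begin

text \<open>
  Call two formulas equivalent if they may be exchanged as left disjuncts in \<open>\<turnstile>\<^sub>H\<close>. Every rule from
  (R10) on says precisely that two formulas are equivalent, and (R4)--(R9) make the relation a
  congruence for \<open>\<^bold>\<and>\<close> and \<open>\<^bold>\<or>\<close> that admits distributivity. So negations can be pushed inwards
  and \<open>\<^bold>\<otimes>\<close>, \<open>\<^bold>\<oplus>\<close> replaced by \<open>\<^bold>\<and>\<close>, \<open>\<^bold>\<or>\<close> without losing variables. The semantic half of the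
  theorem then follows from soundness of \<open>\<turnstile>\<^sub>H\<close>, that is, from \<open>Tr\<close> being a prime filter of both
  lattice orders.
\<close>

lemma meet_t_in_Tr [simp]: "meet_t a b \<in> Tr \<longleftrightarrow> a \<in> Tr \<and> b \<in> Tr"
  by (cases a; cases b) (simp_all add: meet_t_def leq_t_def Tr_def)

lemma join_t_in_Tr [simp]: "join_t a b \<in> Tr \<longleftrightarrow> a \<in> Tr \<or> b \<in> Tr"
  by (cases a; cases b) (simp_all add: join_t_def leq_t_def Tr_def)

lemma meet_k_in_Tr [simp]: "meet_k a b \<in> Tr \<longleftrightarrow> a \<in> Tr \<and> b \<in> Tr"
  by (cases a; cases b) (simp_all add: meet_k_def leq_k_def Tr_def)

lemma join_k_in_Tr [simp]: "join_k a b \<in> Tr \<longleftrightarrow> a \<in> Tr \<or> b \<in> Tr"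
  by (cases a; cases b) (simp_all add: join_k_def leq_k_def Tr_def)

lemma neg4_neg4 [simp]: "neg4 (neg4 a) = a"
  by (cases a) simp_all

text \<open>Negation reverses \<open>leq_t\<close> but preserves \<open>leq_k\<close>. So the truth
  operations are exchanged as by De Morgan, while the knowledge operations below commute with
  \<open>neg4\<close>.\<close>

lemma neg4_meet_t [simp]: "neg4 (meet_t a b) = join_t (neg4 a) (neg4 b)"
  by (cases a; cases b) (simp_all add: meet_t_def join_t_def leq_t_def)

lemma neg4_join_t [simp]: "neg4 (join_t a b) = meet_t (neg4 a) (neg4 b)"
  by (cases a; cases b) (simp_all add: meet_t_def join_t_def leq_t_def)

lemma neg4_meet_k [simp]: "neg4 (meet_k a b) = meet_k (neg4 a) (neg4 b)"
  by (cases a; cases b) (simp_all add: meet_k_def leq_k_def)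

lemma neg4_join_k [simp]: "neg4 (join_k a b) = join_k (neg4 a) (neg4 b)"
  by (cases a; cases b) (simp_all add: join_k_def leq_k_def)

lemma derives_H_sound:
  assumes "\<Gamma> \<turnstile>\<^sub>H \<phi>"
  shows "\<Gamma> \<Turnstile>\<^sub>L\<^sub>B \<phi>"
  unfolding models_LB_def
proof (intro allI impI)
  fix h :: "'a fm \<Rightarrow> four"
  assume "hom_four h" "h ` \<Gamma> \<subseteq> Tr"
  from assms this show "h \<phi> \<in> Tr"
    by induction (auto simp: hom_four_def)
qed

lemma derives_Conj_iff: "\<Gamma> \<turnstile>\<^sub>H p \<^bold>\<and> q \<longleftrightarrow> \<Gamma> \<turnstile>\<^sub>H p \<and> \<Gamma> \<turnstile>\<^sub>H q"
  by (metis R1 R2 R3)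

lemma derives_Disj_commute: "\<Gamma> \<turnstile>\<^sub>H p \<^bold>\<or> q \<longleftrightarrow> \<Gamma> \<turnstile>\<^sub>H q \<^bold>\<or> p"
  by (rule iffI[OF R5 R5])

lemma derives_Disj_assoc: "\<Gamma> \<turnstile>\<^sub>H (p \<^bold>\<or> q) \<^bold>\<or> r \<longleftrightarrow> \<Gamma> \<turnstile>\<^sub>H p \<^bold>\<or> (q \<^bold>\<or> r)"
proof
  assume "\<Gamma> \<turnstile>\<^sub>H (p \<^bold>\<or> q) \<^bold>\<or> r"
  \<comment> \<open>(R5) followed by (R7) rotates the three disjuncts; after two rotations a last
    (R5) yields the other bracketing.\<close>
  from R5[OF R7[OF R5[OF R7[OF R5[OF this]]]]] show "\<Gamma> \<turnstile>\<^sub>H p \<^bold>\<or> (q \<^bold>\<or> r)" .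
qed (rule R7)

lemma derives_Disj_Conj_iff:
  "\<Gamma> \<turnstile>\<^sub>H (p \<^bold>\<and> q) \<^bold>\<or> r \<longleftrightarrow> \<Gamma> \<turnstile>\<^sub>H p \<^bold>\<or> r \<and> \<Gamma> \<turnstile>\<^sub>H q \<^bold>\<or> r"
proof -
  have "\<Gamma> \<turnstile>\<^sub>H r \<^bold>\<or> (p \<^bold>\<and> q) \<longleftrightarrow> \<Gamma> \<turnstile>\<^sub>H (r \<^bold>\<or> p) \<^bold>\<and> (r \<^bold>\<or> q)"
    by (rule iffI[OF R8 R9])
  then show ?thesis
    by (simp only: derives_Conj_iff derives_Disj_commute[of _ r])
qed

text \<open>The side disjunct \<open>r\<close> is built in because (R10)--(R23) carry one; plain
  interderivability would not visibly pass through \<open>Disj\<close>.\<close>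

definition equiv_H :: "'v fm \<Rightarrow> 'v fm \<Rightarrow> bool" where
  "equiv_H \<phi> \<psi> \<longleftrightarrow> (\<forall>\<Gamma> r. \<Gamma> \<turnstile>\<^sub>H \<phi> \<^bold>\<or> r \<longleftrightarrow> \<Gamma> \<turnstile>\<^sub>H \<psi> \<^bold>\<or> r)"

lemma equiv_H_refl: "equiv_H \<phi> \<phi>"
  by (simp add: equiv_H_def)

lemma equiv_H_sym: "equiv_H \<phi> \<psi> \<Longrightarrow> equiv_H \<psi> \<phi>"
  by (simp add: equiv_H_def)

lemma equiv_H_trans [trans]: "equiv_H \<phi> \<psi> \<Longrightarrow> equiv_H \<psi> \<chi> \<Longrightarrow> equiv_H \<phi> \<chi>"
  by (simp add: equiv_H_def)

lemma equiv_H_derives: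
  assumes "equiv_H \<phi> \<psi>"
  shows "{\<phi>} \<turnstile>\<^sub>H \<psi>"
proof -
  \<comment> \<open>The target itself serves as side disjunct, so that (R6) can remove it after the
    exchange.\<close>
  have "{\<phi>} \<turnstile>\<^sub>H \<phi> \<^bold>\<or> \<psi>"
    by (simp add: Prem R4)
  then have "{\<phi>} \<turnstile>\<^sub>H \<psi> \<^bold>\<or> \<psi>"
    using assms by (simp add: equiv_H_def)
  then show ?thesis
    by (rule R6)
qed

lemma equiv_H_Conj:
  "equiv_H \<phi> \<phi>' \<Longrightarrow> equiv_H \<psi> \<psi>' \<Longrightarrow> equiv_H (\<phi> \<^bold>\<and> \<psi>) (\<phi>' \<^bold>\<and> \<psi>')"
  by (simp add: equiv_H_def derives_Disj_Conj_iff)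

lemma derives_weaken_left: "\<Gamma> \<turnstile>\<^sub>H p \<^bold>\<or> r \<Longrightarrow> \<Gamma> \<turnstile>\<^sub>H (q \<^bold>\<or> p) \<^bold>\<or> r"
  by (rule R7[OF R5[OF R4]])

lemma derives_weaken_right: "\<Gamma> \<turnstile>\<^sub>H p \<^bold>\<or> r \<Longrightarrow> \<Gamma> \<turnstile>\<^sub>H (p \<^bold>\<or> q) \<^bold>\<or> r"
  by (rule R5[OF derives_Disj_assoc[THEN iffD1, OF R4[OF R5]]])

text \<open>
  (R5) and (R7) alone never change the cyclic order of the disjuncts. We therefore
  weaken until the target formula is disjoined with itself, and then contract by (R6).
\<close>

lemma derives_Disj_swap:
  assumes "\<Gamma> \<turnstile>\<^sub>H (p \<^bold>\<or> q) \<^bold>\<or> r"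
  shows "\<Gamma> \<turnstile>\<^sub>H (q \<^bold>\<or> p) \<^bold>\<or> r"
proof -
  let ?w = "(q \<^bold>\<or> p) \<^bold>\<or> r"
  have "\<Gamma> \<turnstile>\<^sub>H p \<^bold>\<or> (q \<^bold>\<or> r)"
    using assms by (simp only: derives_Disj_assoc)
  then have "\<Gamma> \<turnstile>\<^sub>H ?w \<^bold>\<or> (q \<^bold>\<or> r)"
    by (rule derives_weaken_right[OF derives_weaken_left])
  then have "\<Gamma> \<turnstile>\<^sub>H (q \<^bold>\<or> r) \<^bold>\<or> ?w"
    by (rule R5)
  then have "\<Gamma> \<turnstile>\<^sub>H q \<^bold>\<or> (r \<^bold>\<or> ?w)"
    by (rule derives_Disj_assoc[THEN iffD1])
  then have "\<Gamma> \<turnstile>\<^sub>H (q \<^bold>\<or> p) \<^bold>\<or> (r \<^bold>\<or> ?w)"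
    by (rule derives_weaken_right)
  then have "\<Gamma> \<turnstile>\<^sub>H ?w \<^bold>\<or> ?w"
    by (rule R7)
  then show ?thesis
    by (rule R6)
qed

lemma equiv_H_Disj_commute: "equiv_H (\<phi> \<^bold>\<or> \<psi>) (\<psi> \<^bold>\<or> \<phi>)"
  unfolding equiv_H_def by (intro allI iffI) (erule derives_Disj_swap)+

text \<open>Reassociation absorbs \<psi> into the side disjunct.\<close>

lemma equiv_H_Disj_left: "equiv_H \<phi> \<phi>' \<Longrightarrow> equiv_H (\<phi> \<^bold>\<or> \<psi>) (\<phi>' \<^bold>\<or> \<psi>)"
  by (simp add: equiv_H_def derives_Disj_assoc)

text \<open>The right disjunct is reached by commuting, replacing on the left and commuting
  back.\<close>

lemma equiv_H_Disj:
  "equiv_H \<phi> \<phi>' \<Longrightarrow> equiv_H \<psi> \<psi>' \<Longrightarrow> equiv_H (\<phi> \<^bold>\<or> \<psi>) (\<phi>' \<^bold>\<or> \<psi>')"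
  by (rule equiv_H_trans[OF equiv_H_Disj_left equiv_H_trans[OF equiv_H_Disj_commute
        equiv_H_trans[OF equiv_H_Disj_left equiv_H_Disj_commute]]])

text \<open>With side disjunct \<open>r\<close>, both sides reduce to deriving \<phi> and \<psi>,
  each disjoined with \<open>Disj\<close> of \<chi> and \<open>r\<close>.\<close>

lemma equiv_H_distrib: "equiv_H ((\<phi> \<^bold>\<and> \<psi>) \<^bold>\<or> \<chi>) ((\<phi> \<^bold>\<or> \<chi>) \<^bold>\<and> (\<psi> \<^bold>\<or> \<chi>))"
  by (simp add: equiv_H_def derives_Disj_assoc derives_Disj_Conj_iff)

lemma equiv_H_Neg_Neg: "equiv_H (\<^bold>\<not> (\<^bold>\<not> \<phi>)) \<phi>"
  unfolding equiv_H_def by (intro allI iffI) (erule R10 R11)+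

lemma equiv_H_Neg_Disj: "equiv_H (\<^bold>\<not> (\<phi> \<^bold>\<or> \<psi>)) ((\<^bold>\<not> \<phi>) \<^bold>\<and> (\<^bold>\<not> \<psi>))"
  unfolding equiv_H_def by (intro allI iffI) (erule R12 R13)+

lemma equiv_H_Neg_Conj: "equiv_H (\<^bold>\<not> (\<phi> \<^bold>\<and> \<psi>)) ((\<^bold>\<not> \<phi>) \<^bold>\<or> (\<^bold>\<not> \<psi>))"
  unfolding equiv_H_def by (intro allI iffI) (erule R14 R15)+

lemma equiv_H_KConj: "equiv_H (\<phi> \<^bold>\<otimes> \<psi>) (\<phi> \<^bold>\<and> \<psi>)"
  unfolding equiv_H_def by (intro allI iffI) (erule R16 R17)+

lemma equiv_H_KDisj: "equiv_H (\<phi> \<^bold>\<oplus> \<psi>) (\<phi> \<^bold>\<or> \<psi>)"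
  unfolding equiv_H_def by (intro allI iffI) (erule R18 R19)+

text \<open>Negation does not dualise \<open>KConj\<close>: (R20) and (R21) keep it, and only then
  is it replaced by \<open>Conj\<close>.\<close>

lemma equiv_H_Neg_KConj: "equiv_H (\<^bold>\<not> (\<phi> \<^bold>\<otimes> \<psi>)) ((\<^bold>\<not> \<phi>) \<^bold>\<and> (\<^bold>\<not> \<psi>))"
  by (rule equiv_H_trans[OF _ equiv_H_KConj]) (unfold equiv_H_def, intro allI iffI; erule R20 R21)

lemma equiv_H_Neg_KDisj: "equiv_H (\<^bold>\<not> (\<phi> \<^bold>\<oplus> \<psi>)) ((\<^bold>\<not> \<phi>) \<^bold>\<or> (\<^bold>\<not> \<psi>))"
  by (rule equiv_H_trans[OF _ equiv_H_KDisj]) (unfold equiv_H_def, intro allI iffI; erule R22 R23)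

text \<open>Asking for \<open>equiv_H\<close> instead of interderivability lets normal forms of
  subformulas be substituted under \<open>Conj\<close> and \<open>Disj\<close>.\<close>

definition has_cnf :: "'v fm \<Rightarrow> bool" where
  "has_cnf \<phi> \<longleftrightarrow> (\<exists>\<psi>. conj_of_clauses \<psi> \<and> vars \<psi> = vars \<phi> \<and> equiv_H \<phi> \<psi>)"

lemma has_cnf_if_conj_of_clauses: "conj_of_clauses \<phi> \<Longrightarrow> has_cnf \<phi>"
  unfolding has_cnf_def using equiv_H_refl by blast

lemma has_cnf_literal: "literal \<phi> \<Longrightarrow> has_cnf \<phi>"
  by (intro has_cnf_if_conj_of_clauses conj_of_clauses.intros clause.intros)

lemma has_cnf_equiv_H:
  assumes "equiv_H \<phi> \<psi>" "vars \<phi> = vars \<psi>" "has_cnf \<psi>"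
  shows "has_cnf \<phi>"
  using assms unfolding has_cnf_def by (metis equiv_H_trans)

lemma has_cnf_Conj:
  assumes "has_cnf \<phi>" "has_cnf \<psi>"
  shows "has_cnf (\<phi> \<^bold>\<and> \<psi>)"
proof -
  obtain \<phi>' \<psi>' where
    "conj_of_clauses \<phi>'" "vars \<phi>' = vars \<phi>" "equiv_H \<phi> \<phi>'"
    "conj_of_clauses \<psi>'" "vars \<psi>' = vars \<psi>" "equiv_H \<psi> \<psi>'"
    using assms unfolding has_cnf_def by blast
  then show ?thesis
    unfolding has_cnf_def
    by (intro exI[of _ "\<phi>' \<^bold>\<and> \<psi>'"]) (simp add: conj_of_clauses.intros equiv_H_Conj)
qed

text \<open>First stage of distributing: the right disjunct is a single clause, so the induction on
  the left one bottoms out in a disjunction of two clauses.\<close>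

lemma has_cnf_Disj_clause:
  assumes "conj_of_clauses \<phi>" "clause \<psi>"
  shows "has_cnf (\<phi> \<^bold>\<or> \<psi>)"
  using assms(1)
proof induction
  case (1 \<phi>)
  with assms(2) show ?case
    by (intro has_cnf_if_conj_of_clauses conj_of_clauses.intros clause.intros(2))
next
  case (2 \<phi> \<chi>)
  have "has_cnf ((\<phi> \<^bold>\<or> \<psi>) \<^bold>\<and> (\<chi> \<^bold>\<or> \<psi>))"
    using 2 by (intro has_cnf_Conj)
  then show ?case
    \<comment> \<open>Distributing duplicates \<psi>, which leaves the set of variables
      unchanged.\<close>
    by (rule has_cnf_equiv_H[OF equiv_H_distrib, rotated]) auto
qed

text \<open>Second stage: induction on the right disjunct, with the first stage as base case. As
  \<open>equiv_H_distrib\<close> splits a conjunction on the left, the disjuncts are commuted around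
  it.\<close>

lemma has_cnf_Disj_conj_of_clauses:
  assumes "conj_of_clauses \<phi>" "conj_of_clauses \<psi>"
  shows "has_cnf (\<phi> \<^bold>\<or> \<psi>)"
  using assms(2)
proof induction
  case (1 \<psi>)
  with assms(1) show ?case
    by (rule has_cnf_Disj_clause)
next
  case (2 \<psi> \<chi>)
  have "equiv_H (\<phi> \<^bold>\<or> (\<psi> \<^bold>\<and> \<chi>)) ((\<psi> \<^bold>\<and> \<chi>) \<^bold>\<or> \<phi>)"
    by (rule equiv_H_Disj_commute)
  also have "equiv_H \<dots> ((\<psi> \<^bold>\<or> \<phi>) \<^bold>\<and> (\<chi> \<^bold>\<or> \<phi>))"
    by (rule equiv_H_distrib)
  also have "equiv_H \<dots> ((\<phi> \<^bold>\<or> \<psi>) \<^bold>\<and> (\<phi> \<^bold>\<or> \<chi>))"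
    by (intro equiv_H_Conj equiv_H_Disj_commute)
  finally have "equiv_H (\<phi> \<^bold>\<or> (\<psi> \<^bold>\<and> \<chi>)) ((\<phi> \<^bold>\<or> \<psi>) \<^bold>\<and> (\<phi> \<^bold>\<or> \<chi>))" .
  moreover have "has_cnf ((\<phi> \<^bold>\<or> \<psi>) \<^bold>\<and> (\<phi> \<^bold>\<or> \<chi>))"
    using 2 by (intro has_cnf_Conj)
  ultimately show ?case
    by (elim has_cnf_equiv_H) auto
qed

lemma has_cnf_Disj:
  assumes "has_cnf \<phi>" "has_cnf \<psi>"
  shows "has_cnf (\<phi> \<^bold>\<or> \<psi>)"
proof -
  obtain \<phi>' \<psi>' where *:
    "conj_of_clauses \<phi>'" "vars \<phi>' = vars \<phi>" "equiv_H \<phi> \<phi>'"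
    "conj_of_clauses \<psi>'" "vars \<psi>' = vars \<psi>" "equiv_H \<psi> \<psi>'"
    using assms unfolding has_cnf_def by blast
  then have "has_cnf (\<phi>' \<^bold>\<or> \<psi>')"
    by (intro has_cnf_Disj_conj_of_clauses)
  with * show ?thesis
    by (intro has_cnf_equiv_H[OF equiv_H_Disj[of \<phi> \<phi>' \<psi> \<psi>']]) auto
qed

text \<open>Treating \<phi> and its negation together makes structural induction work: pushing a
  negation inwards leads to negated immediate subformulas.\<close>

lemma has_cnf_both: "has_cnf \<phi> \<and> has_cnf (\<^bold>\<not> \<phi>)"
proof (induction \<phi>)
  case (Var x)
  show ?case
    by (simp add: has_cnf_literal literal.intros)
next
  case (Neg \<phi>)
  then show ?case
    by (auto intro: has_cnf_equiv_H[OF equiv_H_Neg_Neg])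
next
  case (Conj \<phi> \<psi>)
  then show ?case
    by (auto intro: has_cnf_Conj has_cnf_equiv_H[OF equiv_H_Neg_Conj] has_cnf_Disj)
next
  case (Disj \<phi> \<psi>)
  then show ?case
    by (auto intro: has_cnf_Disj has_cnf_equiv_H[OF equiv_H_Neg_Disj] has_cnf_Conj)
next
  case (KConj \<phi> \<psi>)
  then show ?case
    by (auto intro: has_cnf_Conj has_cnf_equiv_H[OF equiv_H_KConj]
        has_cnf_equiv_H[OF equiv_H_Neg_KConj])
next
  case (KDisj \<phi> \<psi>)
  then show ?case
    by (auto intro: has_cnf_Disj has_cnf_equiv_H[OF equiv_H_KDisj]
        has_cnf_equiv_H[OF equiv_H_Neg_KDisj])
qed

theorem theorem3p2p9:
  fixes \<phi> :: "'v::countable fm"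
  shows "\<exists>\<psi>. conj_of_clauses \<psi> \<and> vars \<psi> = vars \<phi> \<and>
           {\<phi>} \<turnstile>\<^sub>H \<psi> \<and> {\<psi>} \<turnstile>\<^sub>H \<phi> \<and> {\<phi>} \<Turnstile>\<^sub>L\<^sub>B \<psi> \<and> {\<psi>} \<Turnstile>\<^sub>L\<^sub>B \<phi>"
proof -
  obtain \<psi> where "conj_of_clauses \<psi>" "vars \<psi> = vars \<phi>" "equiv_H \<phi> \<psi>"
    using has_cnf_both[of \<phi>] unfolding has_cnf_def by blast
  moreover from this have "{\<phi>} \<turnstile>\<^sub>H \<psi>" "{\<psi>} \<turnstile>\<^sub>H \<phi>"
    by (simp_all add: equiv_H_derives equiv_H_sym)
  ultimately show ?thesis
    using derives_H_sound by blast
qed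

end
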